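(* Let $K\subset\mathbb R^3$ be a convex body which possesses an equipotential sphere $\mathcal S$ whose equipotential constants satisfy $\lambda(P)=\lambda_0$ for every $P\in\mathcal S$, where $\lambda_0$ is a fixed number. Then $K$ is a ball.
   Context: A convex body is a compact convex set with nonempty interior. A point $P$ in the interior of a planar convex body $M$ is an equipotential point of $M$ with equipotential constant $\lambda$ if $|AP|\cdot|PB|=\lambda$ for every chord $AB$ of $M$ through $P$ (with $A,B\in\partial M$). A sphere $\mathcal S$ (of positive radius) contained in the interior of a convex body $K\subset\mathbb R^3$ is an equipotential sphere of $K$ if for every point $P\in\mathcal S$, the plane tangent to $\mathcal S$ at $P$ cuts $K$ in a section $K(P)$ such that $P$ is an equipotential point of $K(P)$, with an equipotential constant $\lambda(P)$ (depending on $P$). *)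

theory Defs
  imports "HOL-Analysis.Analysis"
begin

definition convex_body :: "(real^3) set \<Rightarrow> bool" where
  "convex_body K \<longleftrightarrow> compact K \<and> convex K \<and> interior K \<noteq> {}"

text \<open>
  A planar convex body sitting in some plane of 3-space. Interior and boundary are taken
  inside that plane, i.e. they are \<^const>\<open>rel_interior\<close> and \<^const>\<open>rel_frontier\<close>; the condition
  on \<^const>\<open>aff_dim\<close> says that the interior within a plane is nonempty.
\<close>

definition planar_convex_body :: "(real^3) set \<Rightarrow> bool" where
  "planar_convex_body M \<longleftrightarrow> compact M \<and> convex M \<and> aff_dim M = 2"

definition equipotential_point :: "(real^3) set \<Rightarrow> real^3 \<Rightarrow> real \<Rightarrow> bool" where
  "equipotential_point M P l \<longleftrightarrow>
     planar_convex_body M \<and> P \<in> rel_interior M \<and>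
     (\<forall>A\<in>rel_frontier M. \<forall>B\<in>rel_frontier M.
        P \<in> closed_segment A B \<longrightarrow> dist A P * dist P B = l)"

text \<open>The plane tangent at \<open>P\<close> to the sphere with centre \<open>c\<close> through \<open>P\<close>.\<close>

definition tangent_plane :: "real^3 \<Rightarrow> real^3 \<Rightarrow> (real^3) set" where
  "tangent_plane c P = {X. (P - c) \<bullet> (X - P) = 0}"

text \<open>The sphere with centre \<open>c\<close> and radius \<open>r\<close> is equipotential for \<open>K\<close>, with constant
  \<open>lam P\<close> at each of its points \<open>P\<close>.\<close>

definition equipotential_sphere ::
    "(real^3) set \<Rightarrow> real^3 \<Rightarrow> real \<Rightarrow> (real^3 \<Rightarrow> real) \<Rightarrow> bool" where
  "equipotential_sphere K c r lam \<longleftrightarrow>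
     r > 0 \<and> sphere c r \<subseteq> interior K \<and>
     (\<forall>P\<in>sphere c r. equipotential_point (K \<inter> tangent_plane c P) P (lam P))"

end

theory Submission
  imports Defs
begin

text \<open>
  Let \<open>r\<close> be the radius of \<open>S\<close>. If \<open>A\<close> is a boundary point of \<open>K\<close> at tangent distance \<open>t\<close> from
  \<open>S\<close>, the far endpoints \<open>B\<close> of all chords from \<open>A\<close> tangent to \<open>S\<close> have tangent distance
  \<open>s = \<lambda>\<^sub>0 / t\<close>, so they fill a whole circle \<open>|B|\<^sup>2 = r\<^sup>2 + s\<^sup>2\<close>, \<open>A \<bullet> B = r\<^sup>2 - \<lambda>\<^sub>0\<close> (origin at the
  centre of \<open>S\<close>). Repeating this from each such \<open>B\<close> yields boundary points at distance \<open>|A|\<close> from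
  the centre again, and they cover a spherical cap around \<open>A\<close> of size depending on \<open>|A|\<close> only.
  Hence the boundary points at distance \<open>|A|\<close> form an open and closed subset of a sphere.
\<close>

text \<open>The ball is the convex hull of its sphere, so it lies in \<open>K\<close>. A point of
  \<open>K\<close> outside the ball would force the point \<open>y\<close>, where its segment to
  \<open>c\<close> crosses the sphere, into the interior of \<open>K\<close>.\<close>

lemma convex_eq_cball_if_sphere_subset_frontier:
  fixes K :: "'a::euclidean_space set"
  assumes "compact K" "convex K" "c \<in> interior K" "R > 0" "sphere c R \<subseteq> frontier K"
  shows "K = cball c R"
proof
  have cl: "closed K" using assms(1) compact_imp_closed by blast
  have "cball c R = convex hull (sphere c R)"
    using Krein_Milman_frontier[of "cball c R"] frontier_cball[of c R] \<open>R > 0\<close> by simp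
  also have "\<dots> \<subseteq> K"
    using assms cl by (intro hull_minimal) (auto simp: frontier_def)
  finally show "cball c R \<subseteq> K" .
  show "K \<subseteq> cball c R"
  proof (rule ccontr)
    assume "\<not> K \<subseteq> cball c R"
    then obtain x where "x \<in> K" "x \<notin> cball c R" by blast
    then have x: "x \<in> K" "R < norm (x - c)"
      by (simp_all add: dist_norm norm_minus_commute)
    define u where "u = R / norm (x - c)"
    have u: "0 < u" "u < 1" using x \<open>R > 0\<close>
      by (simp_all add: u_def divide_less_eq_1 del: zero_less_norm_iff)
    define y where "y = (1 - u) *\<^sub>R c + u *\<^sub>R x"
    have yc: "y - c = u *\<^sub>R (x - c)" by (simp add: y_def algebra_simps)
    have "norm (y - c) = R" using x \<open>R > 0\<close> unfolding yc by (auto simp: u_def)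
    then have "y \<in> frontier K"
      using assms(5) by (auto simp: dist_norm norm_minus_commute)
    moreover have "c \<noteq> x" using x \<open>R > 0\<close> by auto
    then have "y \<in> open_segment c x"
      using u unfolding y_def in_segment by auto
    then have "y \<in> interior K"
      using in_interior_closure_convex_segment[OF assms(2,3), of x] x closure_subset by blast
    ultimately show False by (simp add: frontier_def)
  qed
qed

text \<open>Restates the equipotential condition through distances along a unit tangent direction.
  Since \<open>P\<close> is interior to \<open>K\<close>, the relative frontier of the section is
  the frontier of \<open>K\<close> cut by the plane.\<close>

lemma equipotential_sphere_chord:
  assumes K: "convex_body K" and S: "equipotential_sphere K c r lam"
    and P: "P \<in> sphere c r" and l: "(P - c) \<bullet> l = 0" "norm l = 1"
    and A: "P - t *\<^sub>R l \<in> frontier K" and B: "P + d *\<^sub>R l \<in> frontier K"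
    and pos: "0 < t" "0 < d"
  shows "t * d = lam P"
proof -
  let ?T = "tangent_plane c P"
  have "?T = {X. (P - c) \<bullet> X = (P - c) \<bullet> P}"
    by (auto simp: tangent_plane_def inner_diff_right)
  then have aff: "affine ?T" using affine_hyperplane by auto
  have "P \<in> interior K \<inter> ?T"
    using S P by (auto simp: equipotential_sphere_def tangent_plane_def)
  then have fr: "rel_frontier (K \<inter> ?T) = frontier K \<inter> ?T"
    using convex_affine_rel_frontier_Int[of K ?T] K aff by (auto simp: convex_body_def)
  have "P - t *\<^sub>R l \<in> ?T" "P + d *\<^sub>R l \<in> ?T" using l by (auto simp: tangent_plane_def)
  moreover have "P \<in> closed_segment (P - t *\<^sub>R l) (P + d *\<^sub>R l)"
  proof -
    \<comment> \<open>The ratio in which \<open>P\<close> divides the chord.\<close>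
    let ?u = "t / (t + d)"
    have "?u * d - (1 - ?u) * t = 0"
      using pos by (simp add: field_simps)
    moreover have "(1 - ?u) *\<^sub>R (P - t *\<^sub>R l) + ?u *\<^sub>R (P + d *\<^sub>R l)
        = P + (?u * d - (1 - ?u) * t) *\<^sub>R l"
      by (simp add: algebra_simps)
    ultimately have "P = (1 - ?u) *\<^sub>R (P - t *\<^sub>R l) + ?u *\<^sub>R (P + d *\<^sub>R l)"
      by (metis add.right_neutral scale_zero_left)
    then show ?thesis unfolding in_segment using pos by (intro exI[of _ ?u]) auto
  qed
  moreover have "equipotential_point (K \<inter> ?T) P (lam P)"
    using S P by (simp add: equipotential_sphere_def)
  ultimately have "dist (P - t *\<^sub>R l) P * dist P (P + d *\<^sub>R l) = lam P"
    using A B unfolding equipotential_point_def fr by blast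
  then show ?thesis using l pos by (simp add: dist_norm)
qed

text \<open>A tangent line through the interior point \<open>P\<close> leaves \<open>K\<close> at
  positive distances in both directions, and \<open>lam P\<close> is their product.\<close>

lemma equipotential_sphere_constant_pos:
  assumes K: "convex_body K" and S: "equipotential_sphere K c r lam" and P: "P \<in> sphere c r"
  shows "0 < lam P"
proof -
  have bd: "bounded K" using K compact_imp_bounded by (auto simp: convex_body_def)
  have int: "P \<in> interior K" using S P by (auto simp: equipotential_sphere_def)
  obtain y where y: "y \<noteq> 0" "orthogonal (P - c) y"
    using orthogonal_to_vector_exists[of "P - c"] by auto
  define l where "l = y /\<^sub>R norm y"
  have l: "(P - c) \<bullet> l = 0" "norm l = 1" using y by (auto simp: l_def orthogonal_def)
  then have "l \<noteq> 0" "- l \<noteq> 0" by auto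
  obtain d where "0 < d" "P + d *\<^sub>R l \<in> frontier K"
    using ray_to_frontier[OF bd int \<open>l \<noteq> 0\<close>] by metis
  moreover obtain t where "0 < t" "P + t *\<^sub>R (- l) \<in> frontier K"
    using ray_to_frontier[OF bd int \<open>- l \<noteq> 0\<close>] by metis
  ultimately show ?thesis
    using equipotential_sphere_chord[OF K S P l, of t d] by (metis mult_pos_pos scaleR_minus_right
        uminus_add_conv_diff add.commute)
qed

text \<open>
  The conditions on \<open>A\<close> and \<open>B\<close> say that the segment \<open>AB\<close> touches the sphere, at a point at
  distance \<open>t\<close> from \<open>A\<close> and \<open>s\<close> from \<open>B\<close>.
\<close>

lemma equipotential_sphere_partner:
  assumes K: "convex_body K" and S: "equipotential_sphere K c r lam"
    and lam: "\<forall>P\<in>sphere c r. lam P = t * s"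
    and A: "A \<in> frontier K" and pos: "0 < t" "0 < s"
    and nA: "(A - c) \<bullet> (A - c) = r\<^sup>2 + t\<^sup>2" and nB: "(B - c) \<bullet> (B - c) = r\<^sup>2 + s\<^sup>2"
    and AB: "(A - c) \<bullet> (B - c) = r\<^sup>2 - t * s"
  shows "B \<in> frontier K"
proof -
  have r: "r > 0" using S by (simp add: equipotential_sphere_def)
  define a b where "a = A - c" and "b = B - c"
  \<comment> \<open>The unit vector from \<open>A\<close> to \<open>B\<close>: the inner product
    conditions give \<open>|b - a| = s + t\<close>.\<close>
  define l where "l = (b - a) /\<^sub>R (s + t)"
  have "(b - a) \<bullet> (b - a) = (s + t)\<^sup>2"
    using nA nB AB unfolding a_def[symmetric] b_def[symmetric]
    by (simp add: inner_diff inner_commute power2_eq_square algebra_simps)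
  then have "norm (b - a) = s + t"
    using pos by (simp add: norm_eq_sqrt_inner)
  then have l1: "norm l = 1" using pos by (simp add: l_def)
  have "a \<bullet> (b - a) = - t * (s + t)"
    using nA AB unfolding a_def[symmetric] b_def[symmetric]
    by (simp add: inner_diff power2_eq_square algebra_simps)
  then have al: "a \<bullet> l = - t"
    using pos by (simp add: l_def del: inner_diff_right)
  \<comment> \<open>The point of tangency, which is the foot of the perpendicular from
    \<open>c\<close> to the line \<open>AB\<close> because
    \<open>a \<bullet> l = - t\<close>.\<close>
  define P where "P = A + t *\<^sub>R l"
  have p: "P - c = a + t *\<^sub>R l" by (simp add: P_def a_def)
  have ll: "l \<bullet> l = 1" using l1 by (simp add: dot_square_norm)
  have pl: "(P - c) \<bullet> l = 0" unfolding p by (simp add: inner_add_left al ll)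
  have "(P - c) \<bullet> (P - c) = r\<^sup>2"
    using nA unfolding p a_def[symmetric]
    by (simp add: inner_add inner_commute[of l a] al ll power2_eq_square)
  then have "norm (P - c) = r" using r by (simp add: norm_eq_sqrt_inner)
  then have P: "P \<in> sphere c r" by (simp add: dist_norm norm_minus_commute)
  have B: "B = P + s *\<^sub>R l"
  proof -
    have "P + s *\<^sub>R l = A + (s + t) *\<^sub>R l" by (simp add: P_def algebra_simps)
    also have "(s + t) *\<^sub>R l = b - a" using pos by (simp add: l_def)
    finally show ?thesis by (simp add: a_def b_def)
  qed
  have bd: "bounded K" using K compact_imp_bounded by (auto simp: convex_body_def)
  have int: "P \<in> interior K" using S P by (auto simp: equipotential_sphere_def)
  have "l \<noteq> 0" using l1 by auto
  \<comment> \<open>The ray from \<open>A\<close> through \<open>P\<close> leaves \<open>K\<close>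
    at some distance \<open>d\<close> beyond \<open>P\<close>. The constant \<open>t * s\<close>
    forces \<open>d = s\<close>, so the exit point is \<open>B\<close>.\<close>
  then obtain d where d: "0 < d" "P + d *\<^sub>R l \<in> frontier K"
    using ray_to_frontier[OF bd int] by metis
  have "t * d = lam P"
    using equipotential_sphere_chord[OF K S P pl l1 _ d(2) pos(1) d(1)] A by (simp add: P_def)
  then have "d = s" using lam P pos by auto
  then show ?thesis using d B by simp
qed

text \<open>As \<open>a\<close> and \<open>b\<close> have equal length, a suitable multiple of
  \<open>a + b\<close> has inner product \<open>k\<close> with both. A vector orthogonal to both,
  available in dimension at least 3, then adjusts the length; \<open>m\<close> says that the
  multiple of \<open>a + b\<close> is not already too long.\<close>

lemma exists_common_inner_product:
  fixes a b :: "'a::euclidean_space"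
  assumes "3 \<le> DIM('a)" and ab: "a \<bullet> a = b \<bullet> b" and m: "4 * k\<^sup>2 \<le> q * (norm (a + b))\<^sup>2"
    and nz: "a + b \<noteq> 0"
  obtains z where "a \<bullet> z = k" "b \<bullet> z = k" "z \<bullet> z = q"
proof -
  have "dim {a, b} \<le> card {a, b}" by (rule dim_le_card') simp
  also have "\<dots> \<le> 2" by (simp add: card_insert_if)
  finally have "dim {a, b} < DIM('a)" using assms(1) by simp
  then obtain y where y: "y \<noteq> 0" "\<And>x. x \<in> span {a, b} \<Longrightarrow> orthogonal y x"
    using orthogonal_to_subspace_exists by blast
  define n where "n = y /\<^sub>R norm y"
  have n: "n \<bullet> n = 1" "a \<bullet> n = 0" "b \<bullet> n = 0"
    using y(1) y(2)[of a] y(2)[of b]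
    by (auto simp: n_def span_base orthogonal_def inner_commute dot_square_norm power2_eq_square)
  define M where "M = (norm (a + b))\<^sup>2"
  have M: "M > 0" using nz by (simp add: M_def)
  have Mab: "(a + b) \<bullet> (a + b) = M" by (simp add: M_def dot_square_norm)
  have ha: "a \<bullet> (a + b) = M / 2" "b \<bullet> (a + b) = M / 2"
    using Mab ab by (auto simp: inner_add inner_commute[of b a])
  define z where "z = (2 * k / M) *\<^sub>R (a + b) + sqrt (q - 4 * k\<^sup>2 / M) *\<^sub>R n"
  have nab: "(a + b) \<bullet> n = 0" "n \<bullet> (a + b) = 0" using n by (auto simp: inner_add inner_commute)
  have ge: "q - 4 * k\<^sup>2 / M \<ge> 0" using m M by (simp add: M_def[symmetric] field_simps)
  have "a \<bullet> z = k" "b \<bullet> z = k" using M n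
    by (simp_all add: z_def inner_add_right[of _ "(2 * k / M) *\<^sub>R (a + b)"] ha)
  moreover have "z \<bullet> z = (2 * k / M)\<^sup>2 * M + (sqrt (q - 4 * k\<^sup>2 / M))\<^sup>2"
  proof -
    have "(\<alpha> *\<^sub>R u + \<beta> *\<^sub>R n) \<bullet> (\<alpha> *\<^sub>R u + \<beta> *\<^sub>R n) = \<alpha>\<^sup>2 * (u \<bullet> u) + \<beta>\<^sup>2"
      if "u \<bullet> n = 0" for \<alpha> \<beta> u
      using that n by (simp add: inner_add inner_commute[of n u] power2_eq_square)
    from this[OF nab(1)] show ?thesis unfolding z_def Mab .
  qed
  then have "z \<bullet> z = q" using M ge by (simp add: power2_eq_square field_simps)
  ultimately show thesis using that by blast
qed

text \<open>\<open>B\<close> is reached from \<open>A\<close> in two partner steps through a common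
  partner \<open>c + z\<close>. The bound \<open>near\<close> ensures that the partner circles of
  \<open>A\<close> and \<open>B\<close> meet.\<close>

lemma equipotential_sphere_cap:
  assumes K: "convex_body K" and S: "equipotential_sphere K c r lam"
    and lam: "\<forall>P\<in>sphere c r. lam P = t * s" and pos: "0 < t" "0 < s"
    and A: "A \<in> frontier K"
    and nA: "(A - c) \<bullet> (A - c) = r\<^sup>2 + t\<^sup>2" and nB: "(B - c) \<bullet> (B - c) = r\<^sup>2 + t\<^sup>2"
    and near: "(norm (A - B))\<^sup>2 * (r\<^sup>2 + s\<^sup>2) < 4 * r\<^sup>2 * (s + t)\<^sup>2"
  shows "B \<in> frontier K"
proof -
  define a b where "a = A - c" and "b = B - c"
  define k where "k = r\<^sup>2 - t * s"
  define M where "M = (norm (a + b))\<^sup>2"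
  have "M + (norm (A - B))\<^sup>2 = 4 * (r\<^sup>2 + t\<^sup>2)"
  proof -
    have "A - B = a - b" by (simp add: a_def b_def)
    then show ?thesis
      using nA nB unfolding a_def[symmetric] b_def[symmetric]
      by (simp add: M_def inner_add inner_diff flip: dot_square_norm)
  qed
  then have "M * (r\<^sup>2 + s\<^sup>2) = 4 * (r\<^sup>2 + t\<^sup>2) * (r\<^sup>2 + s\<^sup>2) - (norm (A - B))\<^sup>2 * (r\<^sup>2 + s\<^sup>2)"
    by algebra
  \<comment> \<open>This identity turns \<open>near\<close> into the length condition for a common
    partner.\<close>
  moreover have "4 * (r\<^sup>2 + t\<^sup>2) * (r\<^sup>2 + s\<^sup>2) - 4 * r\<^sup>2 * (s + t)\<^sup>2 = 4 * k\<^sup>2"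
    unfolding k_def by algebra
  ultimately have lt: "4 * k\<^sup>2 < (r\<^sup>2 + s\<^sup>2) * M" using near by (simp add: mult.commute)
  \<comment> \<open>Strictness of \<open>near\<close> excludes that \<open>A\<close> and
    \<open>B\<close> are antipodal.\<close>
  have "M \<noteq> 0" using lt by (auto simp: not_less)
  then have "a + b \<noteq> 0" by (auto simp: M_def)
  then obtain z where z: "a \<bullet> z = k" "b \<bullet> z = k" "z \<bullet> z = r\<^sup>2 + s\<^sup>2"
    using exists_common_inner_product[of a b k "r\<^sup>2 + s\<^sup>2"] lt nA nB
    by (auto simp: a_def b_def M_def)
  have "c + z \<in> frontier K"
    using equipotential_sphere_partner[OF K S lam A pos nA, of "c + z"] z by (simp add: a_def k_def)
  \<comment> \<open>The step back to \<open>B\<close> exchanges the roles of \<open>t\<close> and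
    \<open>s\<close>.\<close>
  then show ?thesis
    using equipotential_sphere_partner[OF K S _ _ pos(2,1), of "c + z" B] z nB lam
    by (simp add: b_def k_def mult.commute inner_commute)
qed

theorem theorem7:
  fixes K :: "(real^3) set" and c :: "real^3" and r :: real
    and lam :: "real^3 \<Rightarrow> real" and lam0 :: real
  assumes "convex_body K"
    and "equipotential_sphere K c r lam"
    and "\<forall>P\<in>sphere c r. lam P = lam0"
  shows "\<exists>a R. R > 0 \<and> K = cball a R"
proof -
  note K = assms(1) and S = assms(2)
  have K': "compact K" "convex K" "bounded K"
    using K compact_imp_bounded by (auto simp: convex_body_def)
  have r: "r > 0" and sph: "sphere c r \<subseteq> interior K"
    using S by (auto simp: equipotential_sphere_def)
  have "cball c r = convex hull (sphere c r)"
    using Krein_Milman_frontier[of "cball c r"] frontier_cball[of c r] r by simp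
  also have "\<dots> \<subseteq> interior K" using sph K' by (intro hull_minimal) auto
  finally have cb: "cball c r \<subseteq> interior K" .
  then have c: "c \<in> interior K" using r by auto
  have lam0: "lam0 > 0"
  proof -
    obtain P where "P \<in> sphere c r" using vector_choose_dist[of r c] r by auto
    then show ?thesis using equipotential_sphere_constant_pos[OF K S] assms(3) by metis
  qed
  have "K \<noteq> {}" "K \<noteq> UNIV" using c interior_subset K'(3) not_bounded_UNIV by blast+
  then obtain A where A: "A \<in> frontier K" using frontier_not_empty by blast
  define R where "R = norm (A - c)"
  have "A \<notin> cball c r" using A cb by (auto simp: frontier_def)
  then have R: "r < R" by (simp add: R_def dist_norm norm_minus_commute)
  then have Rpos: "R > 0" using r by simp
  \<comment> \<open>The tangent length from \<open>A\<close>; it is real and positive because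
    \<open>A\<close> lies outside \<open>cball c r\<close>.\<close>
  define t where "t = sqrt (R\<^sup>2 - r\<^sup>2)"
  have "r\<^sup>2 < R\<^sup>2" using R r by (simp add: power_strict_mono)
  then have t: "t > 0" "R\<^sup>2 = r\<^sup>2 + t\<^sup>2" by (auto simp: t_def)
  define s where "s = lam0 / t"
  have s: "s > 0" using lam0 t by (simp add: s_def)
  have lam: "\<forall>P\<in>sphere c r. lam P = t * s" using assms(3) t by (simp add: s_def)
  have inner_sphere: "(X - c) \<bullet> (X - c) = r\<^sup>2 + t\<^sup>2" if "X \<in> sphere c R" for X
    using that t by (simp add: dot_square_norm dist_norm norm_minus_commute)
  \<comment> \<open>The distance at which the cap bound becomes an equality. It is the same for all
    points of \<open>sphere c R\<close>, so it serves as a uniform radius for openness.\<close>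
  define e where "e = sqrt (4 * r\<^sup>2 * (s + t)\<^sup>2 / (r\<^sup>2 + s\<^sup>2))"
  have q: "r\<^sup>2 + s\<^sup>2 > 0" using r by (simp add: add_pos_nonneg)
  have e: "e > 0" using r s t q by (simp add: e_def)
  let ?T = "sphere c R \<inter> frontier K"
  have "openin (top_of_set (sphere c R)) ?T"
    unfolding openin_euclidean_subtopology_iff
  proof (intro conjI ballI exI[of _ e] impI)
    fix X Y assume X: "X \<in> ?T" and Y: "Y \<in> sphere c R" and "dist Y X < e"
    then have "norm (X - Y) < e" by (simp add: dist_norm norm_minus_commute)
    then have "(norm (X - Y))\<^sup>2 < e\<^sup>2" by (simp add: power_strict_mono)
    also have "e\<^sup>2 = 4 * r\<^sup>2 * (s + t)\<^sup>2 / (r\<^sup>2 + s\<^sup>2)" using q by (simp add: e_def)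
    finally have "(norm (X - Y))\<^sup>2 * (r\<^sup>2 + s\<^sup>2) < 4 * r\<^sup>2 * (s + t)\<^sup>2"
      using q by (simp add: pos_less_divide_eq)
    then have "Y \<in> frontier K"
      using equipotential_sphere_cap[OF K S lam t(1) s] X Y inner_sphere by blast
    then show "Y \<in> ?T" using Y by simp
  qed (use e in auto)
  moreover have "closedin (top_of_set (sphere c R)) ?T"
    by (simp add: closedin_closed_Int frontier_closed)
  moreover have "connected (sphere c R)" by (rule connected_sphere) simp
  moreover have "A \<in> ?T" using A by (simp add: R_def dist_norm norm_minus_commute)
  ultimately have "?T = sphere c R" unfolding connected_clopen by blast
  then have "sphere c R \<subseteq> frontier K" by blast
  then have "K = cball c R"
    by (rule convex_eq_cball_if_sphere_subset_frontier[OF K'(1,2) c Rpos])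
  then show ?thesis using Rpos by blast
qed

end
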